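(* Let $n$ and $a$ be relatively prime positive integers and $s\ge1$, and assume the Euclidean algorithm with $n$ and $a$ (in the generalized sense described in the context) produces the symmetric sequence of quotients $q_1,\ldots,q_s,q_s,\ldots,q_1$, with remainders $r_1=n,r_2=a,r_3,\ldots,r_{2s+1}=1,r_{2s+2}=0$. If $i$ and $j$ are integers with $0\le j\le i\le s$, then $$r_{i-j+1}r_{i+j+1}+r_{2s+2-i-j}r_{2s+2-i+j}=n\cdot\mathfrak{r}^+_{i,j},$$ $$r_{i-j+1}r_{i+j+2}-r_{2s+1-i-j}r_{2s+2-i+j}=n\cdot\mathfrak{r}^-_{i,j},$$ where $\mathfrak{r}^+_{i,j}$ and $\mathfrak{r}^-_{i,j}$ are the $(2j+1)$th and $(2j+2)$th remainders, respectively, of the Euclidean algorithm performed with the reduced numerator and denominator of the symmetric continued fraction $[q_{i-j+1},\ldots,q_s,q_s,\ldots,q_{i-j+1}]$.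
   Context: Generalized Euclidean algorithm: for a finite sequence $(u_1,\ldots,u_m)$ ($m\ge0$) of positive integers, its remainders are $\rho_1,\ldots,\rho_{m+2}$ defined by $\rho_{m+2}=0$, $\rho_{m+1}=1$, $\rho_k=u_k\rho_{k+1}+\rho_{k+2}$ for $1\le k\le m$; the $k$th remainder is $\rho_k$. For $m\ge1$, $\rho_1/\rho_2$ equals the simple continued fraction $[u_1,\ldots,u_m]=u_1+\cfrac{1}{u_2+\cfrac{1}{\ddots+\cfrac{1}{u_m}}}$ in lowest terms, and $\rho_1,\rho_2$ are its reduced numerator and denominator; the Euclidean algorithm performed with them (allowing, by convention, the last quotient to be $1$: an ordinary final step $r_l=q_l\cdot1+0$ may be rewritten as $r_l=(q_l-1)\cdot1+1$, $1=1\cdot1+0$) has quotients $u_1,\ldots,u_m$ and remainders $\rho_1,\ldots,\rho_{m+2}$. For the empty sequence ($m=0$), the remainders are $\rho_1=1,\rho_2=0$. "The Euclidean algorithm with $n$ and $a$ produces quotients $(u_1,\ldots,u_m)$" means $n=\rho_1$, $a=\rho_2$ for that sequence, with remainders $r_k=\rho_k$. *)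

theory Defs
  imports Complex_Main
begin

text \<open>
  Indices of remainders start at \<open>1\<close>: with \<open>m = length us\<close>, the remainders are
  \<open>r 1, \<dots>, r (m + 2)\<close>, and the other values of \<open>r\<close> are unconstrained. A final quotient
  \<open>1\<close> is allowed, so \<open>a\<close> and \<open>b\<close> alone do not determine \<open>us\<close>.
\<close>

definition euclid_remainders :: "int \<Rightarrow> int \<Rightarrow> int list \<Rightarrow> (nat \<Rightarrow> int) \<Rightarrow> bool" where
  "euclid_remainders a b us r \<longleftrightarrow>
     (\<forall>u\<in>set us. 0 < u) \<and>
     a = r 1 \<and> b = r 2 \<and>
     (\<forall>k\<in>{1..length us}. r k = us ! (k - 1) * r (k + 1) + r (k + 2)) \<and>
     r (length us + 1) = 1 \<and> r (length us + 2) = 0"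

fun cfrac :: "int list \<Rightarrow> rat" where
  "cfrac [u] = of_int u"
| "cfrac (u # v # us) = of_int u + 1 / cfrac (v # us)"

text \<open>The empty continued fraction has no value; by convention it is read as \<open>1 / 0\<close>.\<close>

definition cfrac_num :: "int list \<Rightarrow> int" where
  "cfrac_num us = (if us = [] then 1 else fst (quotient_of (cfrac us)))"

definition cfrac_den :: "int list \<Rightarrow> int" where
  "cfrac_den us = (if us = [] then 0 else snd (quotient_of (cfrac us)))"

text \<open>The sequence \<open>q k, \<dots>, q s, q s, \<dots>, q k\<close>, which is empty for \<open>k = s + 1\<close>.\<close>

definition sym_quotients :: "(nat \<Rightarrow> int) \<Rightarrow> nat \<Rightarrow> nat \<Rightarrow> int list" where
  "sym_quotients q k s = map q [k..<s + 1] @ rev (map q [k..<s + 1])"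

text \<open>
  Every sequence of positive integers has remainders, they are unique, and they start with
  the reduced numerator and denominator of the continued fraction.
\<close>

lemma euclid_remainders_Nil: "euclid_remainders a b [] r \<longleftrightarrow> a = 1 \<and> b = 0 \<and> r 1 = 1 \<and> r 2 = 0"
  by (auto simp: euclid_remainders_def numeral_2_eq_2)

lemma euclid_remainders_Cons:
  "euclid_remainders a b (u # us) r \<longleftrightarrow>
     0 < u \<and> a = r 1 \<and> a = u * b + r 3 \<and> euclid_remainders b (r 3) us (\<lambda>k. r (k + 1))"
proof -
  have split: "(\<forall>k\<in>{1..length (u # us)}. P k) \<longleftrightarrow> P 1 \<and> (\<forall>k\<in>{1..length us}. P (k + 1))" for P
  proof -
    have "{1..length (u # us)} = insert 1 ((\<lambda>k. k + 1) ` {1..length us})"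
      by auto
    then show ?thesis by (simp only: ball_simps)
  qed
  have nth: "(u # us) ! (k + 1 - 1) = us ! (k - 1)" if "k \<in> {1..length us}" for k
    using that by (cases k) auto
  have "(\<forall>k\<in>{1..length us}. r (k + 1) = (u # us) ! (k + 1 - 1) * r (k + 1 + 1) + r (k + 1 + 2)) \<longleftrightarrow>
      (\<forall>k\<in>{1..length us}. r (k + 1) = us ! (k - 1) * r (k + 1 + 1) + r (k + 2 + 1))"
    by (intro ball_cong refl) (simp only: nth, simp)
  moreover have "r (1 + 1) = r 2" "r (2 + 1) = r 3" "r (1 + 2) = r 3"
    by (simp_all add: numeral_2_eq_2 numeral_3_eq_3)
  ultimately show ?thesis
    unfolding euclid_remainders_def split by (auto simp: ac_simps)
qed

lemma euclid_remainders_cfrac: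
  assumes "euclid_remainders a b us r"
  shows "a = cfrac_num us" and "b = cfrac_den us"
proof -
  have main: "coprime a b \<and> 0 < a \<and> 0 \<le> b \<and>
      (us \<noteq> [] \<longrightarrow> 0 < b \<and> cfrac us = of_int a / of_int b)"
    using assms
  proof (induction us arbitrary: a b r)
    case Nil
    then show ?case by (simp add: euclid_remainders_Nil)
  next
    case (Cons u us)
    define c where "c = r 3"
    have u: "0 < u" and a: "a = u * b + c"
      and tl: "euclid_remainders b c us (\<lambda>k. r (k + 1))"
      using Cons.prems by (simp_all add: euclid_remainders_Cons c_def)
    note IH = Cons.IH[OF tl]
    have "coprime a b"
    proof -
      have "gcd b (u * b + c) = gcd b c" by (rule gcd_add_mult)
      then show ?thesis using IH by (simp add: a coprime_iff_gcd_eq_1 gcd.commute)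
    qed
    moreover have "0 < a"
      using IH u unfolding a by (simp add: add_pos_nonneg)
    moreover have "cfrac (u # us) = of_int a / of_int b"
    proof (cases us)
      case Nil
      then have "b = 1" "c = 0" using tl by (simp_all add: euclid_remainders_Nil)
      then show ?thesis using Nil a by simp
    next
      case (Cons v vs)
      then have "cfrac (u # us) = of_int u + of_int c / of_int b"
        using IH by simp
      then show ?thesis using IH a by (simp add: field_simps)
    qed
    ultimately show ?case using IH by simp
  qed
  then have "quotient_of (cfrac us) = (a, b)" if "us \<noteq> []"
    using that by (simp add: Fract_of_int_quotient [symmetric] quotient_of_Fract)
  moreover have "a = 1" "b = 0" if "us = []"
    using assms that by (simp_all add: euclid_remainders_Nil)
  ultimately show "a = cfrac_num us" "b = cfrac_den us"
    by (auto simp: cfrac_num_def cfrac_den_def)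
qed

lemma euclid_remainders_exist:
  assumes "\<forall>u\<in>set us. 0 < u"
  shows "\<exists>r. euclid_remainders (cfrac_num us) (cfrac_den us) us r"
proof -
  have "\<exists>a b r. euclid_remainders a b us r"
    using assms
  proof (induction us)
    case Nil
    have "euclid_remainders 1 0 [] (\<lambda>k. if k = 1 then 1 else 0)"
      by (simp add: euclid_remainders_Nil)
    then show ?case by blast
  next
    case (Cons u us)
    then obtain a b r where r: "euclid_remainders a b us r" by auto
    define r' where "r' = r(0 := u * a + b)"
    have "euclid_remainders a b us r'" "r' 2 = b" "r' 0 = u * a + b"
      using r by (auto simp: euclid_remainders_def r'_def)
    with Cons.prems have "euclid_remainders (u * a + b) a (u # us) (\<lambda>k. r' (k - 1))"
      by (simp add: euclid_remainders_Cons del: One_nat_def)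
    then show ?case by blast
  qed
  then show ?thesis using euclid_remainders_cfrac by blast
qed

lemma euclid_remainders_unique:
  assumes "euclid_remainders a b us r" "euclid_remainders a' b' us r'"
    and "k \<in> {1..length us + 2}"
  shows "r k = r' k"
  using assms
proof (induction us arbitrary: a b a' b' r r' k)
  case Nil
  then have "k = 1 \<or> k = 2" by auto
  then show ?case using Nil by (auto simp: euclid_remainders_Nil)
next
  case (Cons u us)
  have tl: "euclid_remainders b (r 3) us (\<lambda>k. r (k + 1))"
    "euclid_remainders b' (r' 3) us (\<lambda>k. r' (k + 1))"
    using Cons.prems by (simp_all add: euclid_remainders_Cons)
  note IH = Cons.IH[OF tl]
  show ?case
  proof (cases "k = 1")
    case True
    have "r 2 = r' 2" "r 3 = r' 3"
      using IH[of 1] IH[of 2] by (simp_all add: numeral_2_eq_2 numeral_3_eq_3)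
    moreover have "b = r 2" "b' = r' 2"
      using Cons.prems by (simp_all add: euclid_remainders_def)
    ultimately show ?thesis
      using Cons.prems True by (simp add: euclid_remainders_Cons)
  next
    case False
    then have "k - 1 \<in> {1..length us + 2}" "k - 1 + 1 = k"
      using Cons.prems(3) by auto
    then show ?thesis using IH[of "k - 1"] by metis
  qed
qed

end

theory Submission
  imports Defs
begin

text \<open>
  Put \<open>d = i - j\<close> and write \<open>p k = r (2 * s + 3 - k)\<close> for the reversed remainders. Because the
  quotients are symmetric, \<open>(- 1) ^ k * p k\<close> satisfies the same three-term recurrence as \<open>r\<close>,
  hence so does \<open>G k = r (d + 1) * r (d + k) - (- 1) ^ k * p (d + 1) * p (d + k)\<close>. The quotients
  occurring in it for \<open>k \<ge> 1\<close> are those of the inner continued fraction, so \<open>G\<close> is determined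
  by its final two values. These are \<open>r (d + 1) * p (d + 2) + p (d + 1) * r (d + 2)\<close>, which does
  not depend on \<open>d\<close> and equals \<open>n\<close> for \<open>d = 0\<close>, and \<open>0\<close>. So \<open>G k = n * \<rr> k\<close>; the two
  claims are the cases \<open>k = 2 * j + 1\<close> and \<open>k = 2 * j + 2\<close>.
\<close>

lemma length_sym_quotients: "length (sym_quotients q k s) = 2 * (s + 1 - k)"
  by (simp add: sym_quotients_def del: upt_Suc)

text \<open>The entry at position \<open>m\<close> has absolute index \<open>k + m\<close>; past the
  centre, the reflection \<open>c \<mapsto> 2 * s + 1 - c\<close> folds this index back.\<close>

lemma nth_sym_quotients:
  assumes "m < 2 * (s + 1 - k)"
  shows "sym_quotients q k s ! m = (if k + m \<le> s then q (k + m) else q (2 * s + 1 - k - m))"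
proof (cases "m < s + 1 - k")
  case True
  then have "k + m \<le> s" by simp
  with True show ?thesis by (simp add: sym_quotients_def nth_append del: upt_Suc)
next
  case False
  then have "\<not> k + m \<le> s" by linarith
  moreover have "k + (s + 1 - k - Suc (m - (s + 1 - k))) = 2 * s + 1 - k - m"
    using False assms by linarith
  ultimately show ?thesis
    using False assms by (simp add: sym_quotients_def nth_append rev_nth del: upt_Suc)
qed

text \<open>Descending induction on pairs of consecutive values; going down needs no subtraction, so
  a semiring suffices.\<close>

lemma recurrence_determined_by_end:
  fixes x y :: "nat \<Rightarrow> 'a::semiring_0"
  assumes "\<And>k. \<lbrakk>1 \<le> k; k \<le> L\<rbrakk> \<Longrightarrow> x k = w k * x (k + 1) + x (k + 2)"
    and "\<And>k. \<lbrakk>1 \<le> k; k \<le> L\<rbrakk> \<Longrightarrow> y k = w k * y (k + 1) + y (k + 2)"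
    and "x (L + 1) = y (L + 1)" "x (L + 2) = y (L + 2)"
    and "1 \<le> k" "k \<le> L + 2"
  shows "x k = y k"
proof -
  have "x k = y k \<and> x (k + 1) = y (k + 1)" if "1 \<le> k" "k \<le> L + 1" for k
    using that(2)
  proof (induction rule: inc_induct)
    case base
    then show ?case using assms(3,4) by simp
  next
    case (step m)
    then have "1 \<le> m" "m \<le> L" using that(1) by auto
    with step.IH show ?case by (simp add: assms(1)[of m] assms(2)[of m])
  qed
  from this[of k] show ?thesis
    using assms(4-6) by (cases "k = L + 2") auto
qed

context
  fixes r :: "nat \<Rightarrow> int" and v :: "nat \<Rightarrow> int" and s :: nat
  assumes rec: "\<And>k. \<lbrakk>1 \<le> k; k \<le> 2 * s\<rbrakk> \<Longrightarrow> r k = v k * r (k + 1) + r (k + 2)"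
    and sym: "\<And>k. \<lbrakk>1 \<le> k; k \<le> 2 * s\<rbrakk> \<Longrightarrow> v (2 * s + 1 - k) = v k"
begin

text \<open>This is \<open>rec\<close> at the mirrored index \<open>2 * s + 1 - k\<close>, whose
  quotient is again \<open>v k\<close> by \<open>sym\<close>.\<close>

lemma reversed_recurrence:
  assumes "1 \<le> k" "k \<le> 2 * s"
  shows "r (2 * s + 1 - k) = v k * r (2 * s + 2 - k) + r (2 * s + 3 - k)"
proof -
  have "2 * s + 1 - k + 1 = 2 * s + 2 - k" "2 * s + 1 - k + 2 = 2 * s + 3 - k"
    using assms by simp_all
  then show ?thesis
    using rec[of "2 * s + 1 - k"] sym[of k] assms by simp
qed

text \<open>Up to sign, the left side is the Casoratian of two solutions of one recurrence. Each
  step negates the Casoratian, and the alternating signs absorb this.\<close>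

lemma reversed_invariant:
  assumes final: "r (2 * s + 1) = 1" "r (2 * s + 2) = 0" and "d \<le> 2 * s"
  shows "r (d + 1) * r (2 * s + 1 - d) + r (2 * s + 2 - d) * r (d + 2) = r 1"
  using \<open>d \<le> 2 * s\<close>
proof (induction d)
  case 0
  then show ?case using final by simp
next
  case (Suc d)
  have "r (d + 1) = v (d + 1) * r (d + 2) + r (d + 3)"
    using rec[of "d + 1"] Suc.prems by (simp add: numeral_2_eq_2 numeral_3_eq_3)
  moreover have "r (2 * s - d) = v (d + 1) * r (2 * s + 1 - d) + r (2 * s + 2 - d)"
    using reversed_recurrence[of "d + 1"] Suc.prems by simp
  moreover have "r (d + 1) * r (2 * s + 1 - d) + r (2 * s + 2 - d) * r (d + 2) = r 1"
    using Suc by simp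
  \<comment> \<open>Both sums contain \<open>v (d + 1) * r (d + 2) * r (2 * s + 1 - d)\<close>,
    which cancels.\<close>
  ultimately have "r (d + 2) * r (2 * s - d) + r (2 * s + 1 - d) * r (d + 3) = r 1"
    by (simp add: algebra_simps)
  then show ?case by (simp add: numeral_2_eq_2 numeral_3_eq_3)
qed

lemma symmetric_products:
  assumes final: "r (2 * s + 1) = 1" "r (2 * s + 2) = 0"
    and "d \<le> s"
    and inner: "\<And>k. \<lbrakk>1 \<le> k; k \<le> 2 * (s - d)\<rbrakk> \<Longrightarrow> x k = v (d + k) * x (k + 1) + x (k + 2)"
      "x (2 * (s - d) + 1) = 1" "x (2 * (s - d) + 2) = 0"
    and "1 \<le> k" "k \<le> 2 * (s - d) + 2"
  shows "r (d + 1) * r (d + k) - (- 1) ^ k * r (2 * s + 2 - d) * r (2 * s + 3 - d - k) = r 1 * x k"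
proof -
  define G where
    "G k = r (d + 1) * r (d + k) - (- 1) ^ k * r (2 * s + 2 - d) * r (2 * s + 3 - d - k)" for k
  have "G k = r 1 * x k"
  proof (rule recurrence_determined_by_end[where x = G and y = "\<lambda>k. r 1 * x k"])
    fix k assume k: "1 \<le> k" "k \<le> 2 * (s - d)"
    have "r (d + k) = v (d + k) * r (d + (k + 1)) + r (d + (k + 2))"
      using rec[of "d + k"] k \<open>d \<le> s\<close> by (simp add: add.assoc)
    moreover have "r (2 * s + 3 - d - (k + 2)) =
        v (d + k) * r (2 * s + 3 - d - (k + 1)) + r (2 * s + 3 - d - k)"
      using reversed_recurrence[of "d + k"] k \<open>d \<le> s\<close> by (simp add: eval_nat_numeral)
    ultimately show "G k = v (d + k) * G (k + 1) + G (k + 2)"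
      unfolding G_def by (simp add: algebra_simps)
    show "r 1 * x k = v (d + k) * (r 1 * x (k + 1)) + r 1 * x (k + 2)"
      unfolding inner(1)[OF k] by (simp add: algebra_simps)
  next
    have "d + (2 * (s - d) + 1) = 2 * s + 1 - d" "2 * s + 3 - d - (2 * (s - d) + 1) = d + 2"
      using \<open>d \<le> s\<close> by simp_all
    \<comment> \<open>The exponent is odd, so the difference in \<open>G\<close> becomes the
      invariant sum.\<close>
    then show "G (2 * (s - d) + 1) = r 1 * x (2 * (s - d) + 1)"
      using reversed_invariant[OF final, of d] \<open>d \<le> s\<close> inner(2)
      unfolding G_def by (simp add: add.commute)
  next
    have "d + (2 * (s - d) + 2) = 2 * s + 2 - d" "2 * s + 3 - d - (2 * (s - d) + 2) = d + 1"
      using \<open>d \<le> s\<close> by simp_all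
    \<comment> \<open>The exponent is even and both products have the same factors, so they
      cancel.\<close>
    then show "G (2 * (s - d) + 2) = r 1 * x (2 * (s - d) + 2)"
      using inner(3) unfolding G_def by (simp del: add_2_eq_Suc' add_2_eq_Suc)
  qed (use assms in auto)
  then show ?thesis by (simp add: G_def)
qed

end

theorem theorem2:
  fixes n a :: int and s i j :: nat and q :: "nat \<Rightarrow> int" and r \<rr> :: "nat \<Rightarrow> int"
  assumes "0 < n" and "0 < a" and "coprime n a" and "1 \<le> s"
    and "euclid_remainders n a (sym_quotients q 1 s) r"
    and "j \<le> i" and "i \<le> s"
    and "euclid_remainders
           (cfrac_num (sym_quotients q (i - j + 1) s))
           (cfrac_den (sym_quotients q (i - j + 1) s))
           (sym_quotients q (i - j + 1) s) \<rr>"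
  shows "r (i - j + 1) * r (i + j + 1) + r (2 * s + 2 - i - j) * r (2 * s + 2 - i + j)
           = n * \<rr> (2 * j + 1) \<and>
         r (i - j + 1) * r (i + j + 2) - r (2 * s + 1 - i - j) * r (2 * s + 2 - i + j)
           = n * \<rr> (2 * j + 2)"
proof -
  define d where "d = i - j"
  \<comment> \<open>The inner quotients are the middle block
    \<open>v (d + 1), \<dots>, v (2 * s - d)\<close> of the outer ones, so one \<open>v\<close>
    serves both recurrences.\<close>
  define v where "v k = (if k \<le> s then q k else q (2 * s + 1 - k))" for k
  have d: "d \<le> s" using assms by (simp add: d_def)
  have nth: "sym_quotients q (c + 1) s ! (k - 1) = v (c + k)"
    if "1 \<le> k" "k \<le> 2 * (s - c)" for c k
    using that by (simp add: nth_sym_quotients v_def)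
  have n: "n = r 1" and final: "r (2 * s + 1) = 1" "r (2 * s + 2) = 0"
    using assms(5) by (simp_all add: euclid_remainders_def length_sym_quotients)
  have rec: "r k = v k * r (k + 1) + r (k + 2)" if "1 \<le> k" "k \<le> 2 * s" for k
    using assms(5) that nth[of k 0]
    by (auto simp: euclid_remainders_def length_sym_quotients)
  have sym: "v (2 * s + 1 - k) = v k" if "1 \<le> k" "k \<le> 2 * s" for k
    using that by (auto simp: v_def)
  have \<rr>: "\<rr> (2 * (s - d) + 1) = 1" "\<rr> (2 * (s - d) + 2) = 0"
    using assms(8) by (simp_all add: euclid_remainders_def length_sym_quotients d_def [symmetric])
  have inner: "\<rr> k = v (d + k) * \<rr> (k + 1) + \<rr> (k + 2)" if "1 \<le> k" "k \<le> 2 * (s - d)" for k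
    using assms(8) that nth[of k d]
    by (auto simp: euclid_remainders_def length_sym_quotients d_def [symmetric])
  have products: "r (d + 1) * r (d + k) - (- 1) ^ k * r (2 * s + 2 - d) * r (2 * s + 3 - d - k)
      = n * \<rr> k" if "1 \<le> k" "k \<le> 2 * (s - d) + 2" for k
    unfolding n using rec sym final d inner \<rr> that by (rule symmetric_products)
  \<comment> \<open>The truncated subtractions are exact because
    \<open>j \<le> i \<le> s\<close>.\<close>
  have idx: "d + (2 * j + 1) = i + j + 1" "d + (2 * j + 2) = i + j + 2"
    "2 * s + 3 - d - (2 * j + 1) = 2 * s + 2 - i - j"
    "2 * s + 3 - d - (2 * j + 2) = 2 * s + 1 - i - j"
    "2 * s + 2 - d = 2 * s + 2 - i + j"
    using assms(6,7) by (simp_all add: d_def)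
  have "2 * j + 2 \<le> 2 * (s - d) + 2"
    using assms(6,7) by (simp add: d_def)
  then show ?thesis
    using products[of "2 * j + 1"] products[of "2 * j + 2"] unfolding idx
    by (simp add: d_def mult.commute)
qed

end
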